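(* Let $G=(V,E)$ be a uniformly colored directed graph of type $(p,q,r)$ with degree $s$ and coloring function $c:E\to S$. Then the Lie algebra corresponding to $G$ is a uniform Lie algebra of type $(p,q,r)$ and degree $s$, with uniform basis $V\cup S$. Moreover, the correspondence assigning to a uniform Lie algebra with fixed uniform basis its uniformly colored directed graph and the correspondence assigning to a uniformly colored directed graph its uniform Lie algebra (with uniform basis $V\cup S$) are inverse to one another.
   Context: All Lie algebras are finite-dimensional over $\mathbb{R}$. Let $p,q,r$ be positive integers. A nilpotent Lie algebra $\mathfrak{n}$ is uniform of type $(p,q,r)$ if there exist a basis $\mathcal{B}=\{v_i\}_{i=1}^q\cup\{z_j\}_{j=1}^p$ of $\mathfrak{n}$ (a uniform basis) and a positive integer $s$ (the degree) such that: (i) for all $i,j\in\{1,\dots,q\}$ and $l,m\in\{1,\dots,p\}$, $[v_i,z_l]=0$, $[z_l,z_m]=0$ and $[v_i,v_j]\in\{0,\pm z_1,\dots,\pm z_p\}$; (ii) if $[v_i,v_j]$ is nonzero and $[v_i,v_j]=\pm[v_i,v_k]$, then $v_j=v_k$; (iii) for every $l$ there are exactly $r$ pairs $\{v_i,v_j\}$ (necessarily disjoint) with $[v_i,v_j]=z_l$ for one of the two orderings of the pair; (iv) for every $j$ there are exactly $s$ basis vectors $v_i$ with $[v_i,v_j]\neq 0$. Graphs have no loops or multiple edges. A uniform edge coloring of type $(p,q,r)$ ($p,q,r$ positive) with degree $s\ge 1$ on an undirected $s$-regular graph $(V,E)$ with $q$ vertices is a surjective map $c:E\to S$, $|S|=p$,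 such that adjacent edges have different colors (the coloring is proper) and $|c^{-1}(\{k\})|=r$ for every $k\in S$. A directed graph is uniformly colored of type $(p,q,r)$ with degree $s$ if it is an undirected graph with such a coloring, endowed with an orientation (so $(v,w)$ and $(w,v)$ are never both edges). From algebra to graph: to $\mathfrak{n}$ with uniform basis $\{v_i\}_{i=1}^q\cup\{z_j\}_{j=1}^p$ assign the directed graph with vertex set $\{v_i\}_{i=1}^q$, edge set $\{(v_i,v_j): [v_i,v_j]=z_k\text{ for some }k\}$, and coloring with values in $\{z_j\}_{j=1}^p$ giving $(v_i,v_j)$ the color $z_k$ when $[v_i,v_j]=z_k$. From graph to algebra: to a uniformly colored directed graph $(V,E)$ with coloring $c:E\to S$ assign the real vector space with basis $V\cup S$ (disjoint union) and bilinear bracket determined by: $[v,w]=c(v,w)$ if $(v,w)\in E$; $[v,w]=-c(w,v)$ if $(w,v)\in E$; $[v,w]=0$ for other $v,w\in V$; and all brackets involving an element of $S$ are zero. *)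

theory Defs
  imports "HOL-Analysis.Analysis" "HOL-Analysis.Finite_Function_Topology"
begin

text \<open>
  A Lie algebra is given by a subspace \<open>L\<close> of an ambient real vector space and a bracket, which
  is only constrained on \<open>L\<close>.  All Lie algebras are finite-dimensional over the reals.
\<close>

locale lie_algebra =
  fixes L :: "'a::real_vector set" and br :: "'a \<Rightarrow> 'a \<Rightarrow> 'a"
  assumes subspace: "subspace L"
    and finite_dimensional: "\<exists>B. finite B \<and> L = span B"
    and closed: "\<lbrakk>x \<in> L; y \<in> L\<rbrakk> \<Longrightarrow> br x y \<in> L"
    and add_left: "\<lbrakk>x \<in> L; y \<in> L; z \<in> L\<rbrakk> \<Longrightarrow> br (x + y) z = br x z + br y z"
    and add_right: "\<lbrakk>x \<in> L; y \<in> L; z \<in> L\<rbrakk> \<Longrightarrow> br x (y + z) = br x y + br x z"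
    and scale_left: "\<lbrakk>x \<in> L; y \<in> L\<rbrakk> \<Longrightarrow> br (a *\<^sub>R x) y = a *\<^sub>R br x y"
    and scale_right: "\<lbrakk>x \<in> L; y \<in> L\<rbrakk> \<Longrightarrow> br x (a *\<^sub>R y) = a *\<^sub>R br x y"
    and alternating: "x \<in> L \<Longrightarrow> br x x = 0"
    and jacobi: "\<lbrakk>x \<in> L; y \<in> L; z \<in> L\<rbrakk> \<Longrightarrow>
      br x (br y z) + br y (br z x) + br z (br x y) = 0"

primrec lower_central_series ::
  "'a::real_vector set \<Rightarrow> ('a \<Rightarrow> 'a \<Rightarrow> 'a) \<Rightarrow> nat \<Rightarrow> 'a set" where
  "lower_central_series L br 0 = L"
| "lower_central_series L br (Suc k) =
     span {br x y | x y. x \<in> L \<and> y \<in> lower_central_series L br k}"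

definition nilpotent_lie_algebra :: "'a::real_vector set \<Rightarrow> ('a \<Rightarrow> 'a \<Rightarrow> 'a) \<Rightarrow> bool" where
  "nilpotent_lie_algebra L br \<longleftrightarrow>
     lie_algebra L br \<and> (\<exists>k. lower_central_series L br k = {0})"

text \<open>
  The basis is given by the sets \<open>V\<close> of the \<open>v\<^sub>i\<close> and \<open>Z\<close> of the \<open>z\<^sub>j\<close>; the cardinality
  conditions with positive \<open>p\<close> and \<open>q\<close> make both sets finite.
\<close>

definition uniform_basis ::
  "nat \<Rightarrow> nat \<Rightarrow> nat \<Rightarrow> nat \<Rightarrow> 'a::real_vector set \<Rightarrow> ('a \<Rightarrow> 'a \<Rightarrow> 'a) \<Rightarrow> 'a set \<Rightarrow> 'a set \<Rightarrow> bool" where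
  "uniform_basis p q r s L br V Z \<longleftrightarrow>
     p > 0 \<and> q > 0 \<and> r > 0 \<and> s > 0 \<and>
     card V = q \<and> card Z = p \<and> V \<inter> Z = {} \<and> independent (V \<union> Z) \<and> span (V \<union> Z) = L \<and>
     (\<forall>v\<in>V. \<forall>z\<in>Z. br v z = 0) \<and>
     (\<forall>z\<in>Z. \<forall>z'\<in>Z. br z z' = 0) \<and>
     (\<forall>v\<in>V. \<forall>w\<in>V. br v w \<in> {0} \<union> Z \<union> uminus ` Z) \<and>
     (\<forall>u\<in>V. \<forall>v\<in>V. \<forall>w\<in>V. br u v \<noteq> 0 \<and> (br u v = br u w \<or> br u v = - br u w) \<longrightarrow> v = w) \<and>
     (\<forall>z\<in>Z. card {{v, w} | v w. v \<in> V \<and> w \<in> V \<and> br v w = z} = r) \<and>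
     (\<forall>w\<in>V. card {v \<in> V. br v w \<noteq> 0} = s)"

definition uniform_lie_algebra ::
  "nat \<Rightarrow> nat \<Rightarrow> nat \<Rightarrow> nat \<Rightarrow> 'a::real_vector set \<Rightarrow> ('a \<Rightarrow> 'a \<Rightarrow> 'a) \<Rightarrow> bool" where
  "uniform_lie_algebra p q r s L br \<longleftrightarrow>
     nilpotent_lie_algebra L br \<and> (\<exists>V Z. uniform_basis p q r s L br V Z)"

record 'a based_lie_algebra =
  underlying_space :: "'a set"
  bracket :: "'a \<Rightarrow> 'a \<Rightarrow> 'a"
  vbasis :: "'a set"
  zbasis :: "'a set"

definition uniform_based_lie_algebra ::
  "nat \<Rightarrow> nat \<Rightarrow> nat \<Rightarrow> nat \<Rightarrow> 'a::real_vector based_lie_algebra \<Rightarrow> bool" where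
  "uniform_based_lie_algebra p q r s N \<longleftrightarrow>
     nilpotent_lie_algebra (underlying_space N) (bracket N) \<and>
     uniform_basis p q r s (underlying_space N) (bracket N) (vbasis N) (zbasis N)"

text \<open>Undirected graphs: \<open>E\<close> consists of two-element subsets of \<open>V\<close>.\<close>

definition uniform_edge_coloring ::
  "nat \<Rightarrow> nat \<Rightarrow> nat \<Rightarrow> nat \<Rightarrow> 'v set \<Rightarrow> 'v set set \<Rightarrow> ('v set \<Rightarrow> 's) \<Rightarrow> 's set \<Rightarrow> bool" where
  "uniform_edge_coloring p q r s V E c S \<longleftrightarrow>
     p > 0 \<and> q > 0 \<and> r > 0 \<and> s \<ge> 1 \<and>
     finite V \<and> card V = q \<and> E \<subseteq> {e. e \<subseteq> V \<and> card e = 2} \<and>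
     (\<forall>v\<in>V. card {e \<in> E. v \<in> e} = s) \<and>
     c ` E = S \<and> card S = p \<and>
     (\<forall>e\<in>E. \<forall>e'\<in>E. e \<noteq> e' \<and> e \<inter> e' \<noteq> {} \<longrightarrow> c e \<noteq> c e') \<and>
     (\<forall>k\<in>S. card {e \<in> E. c e = k} = r)"

text \<open>Only the values of \<^term>\<open>color\<close> on arcs are meaningful.\<close>

record ('v, 's) colored_digraph =
  verts :: "'v set"
  arcs :: "('v \<times> 'v) set"
  colors :: "'s set"
  color :: "'v \<times> 'v \<Rightarrow> 's"

text \<open>
  The witness \<open>c\<close> is the coloring of the underlying undirected graph; the arcs inherit it.
\<close>

definition uniformly_colored_digraph ::
  "nat \<Rightarrow> nat \<Rightarrow> nat \<Rightarrow> nat \<Rightarrow> ('v, 's) colored_digraph \<Rightarrow> bool" where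
  "uniformly_colored_digraph p q r s G \<longleftrightarrow>
     (\<forall>v w. (v, w) \<in> arcs G \<longrightarrow> (w, v) \<notin> arcs G) \<and>
     (\<exists>c. uniform_edge_coloring p q r s (verts G) {{v, w} | v w. (v, w) \<in> arcs G} c (colors G) \<and>
          (\<forall>v w. (v, w) \<in> arcs G \<longrightarrow> color G (v, w) = c {v, w}))"

definition digraph_of :: "'a::real_vector based_lie_algebra \<Rightarrow> ('a, 'a) colored_digraph" where
  "digraph_of N =
     \<lparr> verts = vbasis N,
       arcs = {(v, w). v \<in> vbasis N \<and> w \<in> vbasis N \<and> bracket N v w \<in> zbasis N},
       colors = zbasis N,
       color = (\<lambda>(v, w). bracket N v w) \<rparr>"

text \<open>
  The real vector space with basis the disjoint union of \<open>V\<close> and \<open>S\<close> is realised inside the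
  finitely supported real functions on the sum type; the basis vectors are the functions
  \<open>vvec v\<close> and \<open>svec k\<close>.
\<close>

definition vvec :: "'v \<Rightarrow> ('v + 's \<Rightarrow>\<^sub>0 real)" where
  "vvec v = Poly_Mapping.single (Inl v) 1"

definition svec :: "'s \<Rightarrow> ('v + 's \<Rightarrow>\<^sub>0 real)" where
  "svec k = Poly_Mapping.single (Inr k) 1"

fun basis_bracket ::
  "('v, 's) colored_digraph \<Rightarrow> 'v + 's \<Rightarrow> 'v + 's \<Rightarrow> ('v + 's \<Rightarrow>\<^sub>0 real)" where
  "basis_bracket G (Inl v) (Inl w) =
     (if (v, w) \<in> arcs G then svec (color G (v, w))
      else if (w, v) \<in> arcs G then - svec (color G (w, v))
      else 0)"
| "basis_bracket G _ _ = 0"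

definition lie_algebra_of ::
  "('v, 's) colored_digraph \<Rightarrow> ('v + 's \<Rightarrow>\<^sub>0 real) based_lie_algebra" where
  "lie_algebra_of G =
     \<lparr> underlying_space = span (vvec ` verts G \<union> svec ` colors G),
       bracket = (\<lambda>f g. \<Sum>x\<in>Poly_Mapping.keys f. \<Sum>y\<in>Poly_Mapping.keys g.
         (Poly_Mapping.lookup f x * Poly_Mapping.lookup g y) *\<^sub>R basis_bracket G x y),
       vbasis = vvec ` verts G,
       zbasis = svec ` colors G \<rparr>"

definition colored_digraph_iso ::
  "('v \<Rightarrow> 'w) \<Rightarrow> ('s \<Rightarrow> 't) \<Rightarrow> ('v, 's) colored_digraph \<Rightarrow> ('w, 't) colored_digraph \<Rightarrow> bool" where
  "colored_digraph_iso f g G H \<longleftrightarrow>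
     bij_betw f (verts G) (verts H) \<and> bij_betw g (colors G) (colors H) \<and>
     (\<forall>v\<in>verts G. \<forall>w\<in>verts G. (v, w) \<in> arcs G \<longleftrightarrow> (f v, f w) \<in> arcs H) \<and>
     (\<forall>(v, w)\<in>arcs G. color H (f v, f w) = g (color G (v, w)))"

definition based_lie_algebra_iso ::
  "('a::real_vector \<Rightarrow> 'b::real_vector) \<Rightarrow> 'a based_lie_algebra \<Rightarrow> 'b based_lie_algebra \<Rightarrow> bool" where
  "based_lie_algebra_iso \<phi> M N \<longleftrightarrow>
     bij_betw \<phi> (underlying_space M) (underlying_space N) \<and>
     (\<forall>x\<in>underlying_space M. \<forall>y\<in>underlying_space M. \<phi> (x + y) = \<phi> x + \<phi> y) \<and>
     (\<forall>a. \<forall>x\<in>underlying_space M. \<phi> (a *\<^sub>R x) = a *\<^sub>R \<phi> x) \<and>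
     (\<forall>x\<in>underlying_space M. \<forall>y\<in>underlying_space M. \<phi> (bracket M x y) = bracket N (\<phi> x) (\<phi> y)) \<and>
     \<phi> ` vbasis M = vbasis N \<and> \<phi> ` zbasis M = zbasis N"

end

theory Submission
  imports Defs
begin

text \<open>
  The bracket of the Lie algebra of a graph takes values in the span of the colors, which is central.
  So all iterated brackets vanish, and the Jacobi identity and nilpotency are automatic.  Conversely,
  independence of the basis ensures that \<^term>\<open>z\<close> and \<^term>\<open>- z'\<close> are never equal for basis vectors
  \<^term>\<open>z\<close> and \<^term>\<open>z'\<close>, so the nonzero brackets orient the edges consistently, and the linear
  extension of the identity on basis vectors is the isomorphism back to the original algebra.
\<close>

section \<open>Linear extension from the free vector space\<close>

text \<open>Scalar multiples are formed through the abstraction function, so evaluating one at a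
  point needs its support to be finite.\<close>

lemma lookup_scaleR: "Poly_Mapping.lookup (a *\<^sub>R f) x = a *\<^sub>R Poly_Mapping.lookup f x"
proof -
  have "finite {i. a *\<^sub>R Poly_Mapping.lookup f i \<noteq> 0}"
    by (rule finite_subset[OF _ finite_keys[of f]]) (auto simp: in_keys_iff)
  then show ?thesis unfolding scaleR_poly_mapping_def by simp
qed

text \<open>The universal property of the free vector space: the linear map sending the basis vector
  at \<open>x\<close> to \<open>b x\<close>.\<close>

definition linext :: "('x \<Rightarrow> 'b::real_vector) \<Rightarrow> ('x \<Rightarrow>\<^sub>0 real) \<Rightarrow> 'b" where
  "linext b f = (\<Sum>x\<in>Poly_Mapping.keys f. Poly_Mapping.lookup f x *\<^sub>R b x)"

lemma linext_superset:
  assumes "finite A" "Poly_Mapping.keys f \<subseteq> A"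
  shows "linext b f = (\<Sum>x\<in>A. Poly_Mapping.lookup f x *\<^sub>R b x)"
  unfolding linext_def
  by (rule sum.mono_neutral_left) (use assms in \<open>auto simp: in_keys_iff\<close>)

lemma linear_linext: "linear (linext b)"
proof (rule linearI)
  fix f g :: "'a \<Rightarrow>\<^sub>0 real" and a :: real
  \<comment> \<open>The three sums run over different supports, and cancellation can shrink that of
    \<open>f + g\<close>. The union serves for all of them.\<close>
  let ?A = "Poly_Mapping.keys f \<union> Poly_Mapping.keys g"
  have A: "finite ?A" by simp
  have "linext b (f + g) = (\<Sum>x\<in>?A. Poly_Mapping.lookup (f + g) x *\<^sub>R b x)"
    using Poly_Mapping.keys_add[of f g] by (intro linext_superset) auto
  also have "\<dots> = linext b f + linext b g"
    unfolding linext_superset[OF A, of f, simplified] linext_superset[OF A, of g, simplified]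
    by (simp add: lookup_add scaleR_add_left sum.distrib)
  finally show "linext b (f + g) = linext b f + linext b g" .
  have "linext b (a *\<^sub>R f) = (\<Sum>x\<in>Poly_Mapping.keys f. Poly_Mapping.lookup (a *\<^sub>R f) x *\<^sub>R b x)"
    by (intro linext_superset) (auto simp: in_keys_iff lookup_scaleR)
  then show "linext b (a *\<^sub>R f) = a *\<^sub>R linext b f"
    by (simp add: linext_def scaleR_sum_right lookup_scaleR)
qed

lemma linext_single [simp]: "linext b (Poly_Mapping.single x a) = a *\<^sub>R b x"
  by (simp add: linext_def)

lemma linext_in_span:
  assumes "\<And>x. b x \<in> span S"
  shows "linext b f \<in> span S"
  unfolding linext_def by (intro span_sum span_scale assms)

text \<open>For fixed \<open>f\<close> this is a finite linear combination of linear maps. It gives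
  linearity of the bracket in its second argument.\<close>

lemma linear_linext_coeff:
  assumes "\<And>x. linear (b x)"
  shows "linear (\<lambda>g. linext (\<lambda>x. b x g) f)"
  unfolding linext_def
  by (intro linear_compose_sum ballI linear_compose_scale_right assms)

text \<open>The coordinate functional at \<open>x\<close> kills every other basis vector, hence
  their span, but takes the value 1 at the basis vector of \<open>x\<close>.\<close>

lemma independent_single: "independent (range (\<lambda>x. Poly_Mapping.single x (1::real)))"
proof -
  have False
    if "Poly_Mapping.single x (1::real) \<in>
      span (range (\<lambda>x. Poly_Mapping.single x 1) - {Poly_Mapping.single x 1})" for x :: 'a
  proof -
    have "Poly_Mapping.lookup (Poly_Mapping.single x (1::real)) x = 0"
      using that
    proof (induction rule: span_induct_alt)
      case (step c y z)
      then show ?case by (auto simp: lookup_add lookup_scaleR lookup_single when_def split: if_splits)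
    qed simp
    then show False by simp
  qed
  then show ?thesis unfolding dependent_def by blast
qed

section \<open>Lie brackets and uniform bases\<close>

text \<open>Polarization: expand the vanishing bracket of \<open>x + y\<close> with itself.\<close>

lemma (in lie_algebra) antisymmetric:
  assumes "x \<in> L" "y \<in> L"
  shows "br x y = - br y x"
proof -
  have "x + y \<in> L" using assms subspace by (simp add: subspace_add)
  then have "br (x + y) (x + y) = br x x + br x y + (br y x + br y y)"
    using assms by (simp add: add_left add_right algebra_simps)
  with \<open>x + y \<in> L\<close> show ?thesis
    using assms by (simp add: alternating eq_neg_iff_add_eq_0)
qed

lemma uniform_basisI:
  assumes "p > 0" "q > 0" "r > 0" "s > 0" "card V = q" "card Z = p" "V \<inter> Z = {}"
    "independent (V \<union> Z)" "span (V \<union> Z) = L"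
    "\<And>v z. v \<in> V \<Longrightarrow> z \<in> Z \<Longrightarrow> br v z = 0"
    "\<And>z z'. z \<in> Z \<Longrightarrow> z' \<in> Z \<Longrightarrow> br z z' = 0"
    "\<And>v w. v \<in> V \<Longrightarrow> w \<in> V \<Longrightarrow> br v w \<in> {0} \<union> Z \<union> uminus ` Z"
    "\<And>u v w. u \<in> V \<Longrightarrow> v \<in> V \<Longrightarrow> w \<in> V \<Longrightarrow> br u v \<noteq> 0 \<Longrightarrow>
       br u v = br u w \<or> br u v = - br u w \<Longrightarrow> v = w"
    "\<And>z. z \<in> Z \<Longrightarrow> card {{v, w} | v w. v \<in> V \<and> w \<in> V \<and> br v w = z} = r"
    "\<And>w. w \<in> V \<Longrightarrow> card {v \<in> V. br v w \<noteq> 0} = s"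
  shows "uniform_basis p q r s L br V Z"
  unfolding uniform_basis_def using assms by blast

text \<open>If \<open>x = y\<close>, then \<open>2 *\<^sub>R x = 0\<close> and \<open>x\<close>
  vanishes; otherwise \<open>x\<close> lies in the span of the other basis vectors. Both contradict
  independence.\<close>

lemma independent_neq_uminus:
  assumes "independent B" "x \<in> B" "y \<in> B"
  shows "x \<noteq> - y"
proof
  assume eq: "x = - y"
  show False
  proof (cases "x = y")
    case True
    with eq have "2 *\<^sub>R x = 0" unfolding scaleR_2 by (simp add: eq_neg_iff_add_eq_0)
    then have "x = 0" by simp
    then show False using assms dependent_zero by blast
  next
    case False
    then have "y \<in> span (B - {x})" using assms(3) by (intro span_base) auto
    then have "x \<in> span (B - {x})" using eq span_neg by blast
    then show False using assms(1,2) unfolding dependent_def by blast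
  qed
qed

text \<open>Joining each neighbour to \<open>u\<close> is a bijection onto the edges at
  \<open>u\<close>. This translates between the degree of a graph and the number of nonzero brackets
  with a basis vector.\<close>

lemma card_incident_edges:
  assumes "\<And>v. (v, v) \<notin> A"
  shows "card {e \<in> {{v, w} | v w. (v, w) \<in> A}. u \<in> e} = card {v. (v, u) \<in> A \<or> (u, v) \<in> A}"
proof -
  have "bij_betw (\<lambda>v. {v, u}) {v. (v, u) \<in> A \<or> (u, v) \<in> A}
      {e \<in> {{v, w} | v w. (v, w) \<in> A}. u \<in> e}"
    unfolding bij_betw_def
  proof
    show "inj_on (\<lambda>v. {v, u}) {v. (v, u) \<in> A \<or> (u, v) \<in> A}"
      by (auto simp: inj_on_def doubleton_eq_iff)
    show "(\<lambda>v. {v, u}) ` {v. (v, u) \<in> A \<or> (u, v) \<in> A} = {e \<in> {{v, w} | v w. (v, w) \<in> A}. u \<in> e}"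
      by (force simp: insert_commute)
  qed
  then show ?thesis by (rule bij_betw_same_card[symmetric])
qed

section \<open>The Lie algebra of a graph\<close>

lemma vvec_eq_iff [simp]: "vvec v = vvec w \<longleftrightarrow> v = w"
  unfolding vvec_def by (metis lookup_single_eq lookup_single_not_eq sum.inject(1) zero_neq_one)

lemma svec_eq_iff [simp]: "svec k = svec l \<longleftrightarrow> k = l"
  unfolding svec_def by (metis lookup_single_eq lookup_single_not_eq sum.inject(2) zero_neq_one)

lemma
  fixes k l :: 'b
  shows svec_neq_uminus [simp]: "svec k \<noteq> (- svec l :: 'a + 'b \<Rightarrow>\<^sub>0 real)"
      "- svec l \<noteq> (svec k :: 'a + 'b \<Rightarrow>\<^sub>0 real)"
    and svec_nonzero [simp]: "svec k \<noteq> (0 :: 'a + 'b \<Rightarrow>\<^sub>0 real)"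
proof -
  show "svec k \<noteq> (0 :: 'a + 'b \<Rightarrow>\<^sub>0 real)" unfolding svec_def by (metis lookup_single_eq lookup_zero zero_neq_one)
  have "independent (range svec :: ('a + 'b \<Rightarrow>\<^sub>0 real) set)"
    by (rule independent_mono[OF independent_single]) (auto simp: svec_def)
  then have "svec k \<noteq> (- svec l :: 'a + 'b \<Rightarrow>\<^sub>0 real)"
    by (intro independent_neq_uminus[of "range svec"]) auto
  then show "svec k \<noteq> (- svec l :: 'a + 'b \<Rightarrow>\<^sub>0 real)"
    "- svec l \<noteq> (svec k :: 'a + 'b \<Rightarrow>\<^sub>0 real)" by (auto dest: sym)
qed

lemma vvec_neq_svec [simp]: "vvec v \<noteq> svec k"
  unfolding vvec_def svec_def by (metis lookup_single_eq lookup_single_not_eq sum.distinct(1) zero_neq_one)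

lemma independent_vvec_svec: "independent (vvec ` V \<union> svec ` S)"
  by (rule independent_mono[OF independent_single]) (auto simp: vvec_def svec_def)

section \<open>The bilinear bracket and nilpotency\<close>

abbreviation (input) "gbr G \<equiv> bracket (lie_algebra_of G)"

text \<open>The defining double sum is an iterated linear extension, so bilinearity reduces to
  linearity of \<open>linext\<close>.\<close>

lemma bracket_linext: "gbr G f g = linext (\<lambda>x. linext (basis_bracket G x) g) f"
  unfolding lie_algebra_of_def linext_def by (simp add: scaleR_sum_right)

lemma bilinear_bracket: "bilinear (gbr G)"
  unfolding bilinear_def bracket_linext
  by (auto intro!: linear_linext linear_linext_coeff)

lemma bracket_vvec [simp]: "gbr G (vvec v) (vvec w) = basis_bracket G (Inl v) (Inl w)"
  unfolding bracket_linext vvec_def by simp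

lemma bracket_svec_right [simp]: "gbr G f (svec k) = 0"
  unfolding bracket_linext svec_def by (simp add: linext_def)

lemma bracket_svec_left [simp]: "gbr G (svec k) g = 0"
  unfolding bracket_linext svec_def by (simp add: linext_def)

lemma bracket_central:
  assumes "z \<in> span (range svec)"
  shows "gbr G f z = 0"
  using assms
proof (induction rule: span_induct_alt)
  case base
  then show ?case by (simp add: bilinear_rzero[OF bilinear_bracket])
next
  case (step c x y)
  then show ?case
    by (auto simp: bilinear_radd[OF bilinear_bracket] bilinear_rmul[OF bilinear_bracket])
qed

text \<open>Basis brackets are 0 or a signed color of an arc, and linear extension stays in the span
  of these values.\<close>

lemma bracket_in_span:
  assumes "\<And>v w. (v, w) \<in> arcs G \<Longrightarrow> color G (v, w) \<in> colors G"
  shows "gbr G f g \<in> span (svec ` colors G)"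
proof -
  have "basis_bracket G x y \<in> span (svec ` colors G)" for x y
    by (cases "(G, x, y)" rule: basis_bracket.cases)
      (auto simp: assms intro!: span_neg span_zero intro: span_base)
  then show ?thesis unfolding bracket_linext by (intro linext_in_span)
qed

lemma basis_bracket_antisym:
  assumes "\<And>v w. (v, w) \<in> arcs G \<Longrightarrow> (w, v) \<notin> arcs G"
  shows "basis_bracket G x y = - basis_bracket G y x"
  using assms by (cases "(G, x, y)" rule: basis_bracket.cases) auto

text \<open>Exchanging the two summation indices turns the double sum into its own negative, because
  the bracket is antisymmetric on basis vectors.\<close>

lemma bracket_alternating:
  assumes "\<And>v w. (v, w) \<in> arcs G \<Longrightarrow> (w, v) \<notin> arcs G"
  shows "gbr G f f = 0"
proof -
  let ?K = "Poly_Mapping.keys f" and ?l = "Poly_Mapping.lookup f"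
  have "gbr G f f = (\<Sum>x\<in>?K. \<Sum>y\<in>?K. (?l x * ?l y) *\<^sub>R basis_bracket G x y)"
    unfolding lie_algebra_of_def by simp
  also have "\<dots> = (\<Sum>y\<in>?K. \<Sum>x\<in>?K. (?l x * ?l y) *\<^sub>R basis_bracket G x y)"
    by (rule sum.swap)
  also have "\<dots> = (\<Sum>y\<in>?K. \<Sum>x\<in>?K. - ((?l y * ?l x) *\<^sub>R basis_bracket G y x))"
    by (intro sum.cong refl, subst basis_bracket_antisym[OF assms]) (auto simp: mult.commute)
  also have "\<dots> = - gbr G f f"
    unfolding lie_algebra_of_def by (simp add: sum_negf)
  finally have "gbr G f f = - gbr G f f" .
  then have "2 *\<^sub>R gbr G f f = 0" unfolding scaleR_2 by (simp add: eq_neg_iff_add_eq_0)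
  then show ?thesis by simp
qed

lemma underlying_space_lie_algebra_of [simp]:
  "underlying_space (lie_algebra_of G) = span (vvec ` verts G \<union> svec ` colors G)"
  by (simp add: lie_algebra_of_def)

lemma vbasis_lie_algebra_of [simp]: "vbasis (lie_algebra_of G) = vvec ` verts G"
  and zbasis_lie_algebra_of [simp]: "zbasis (lie_algebra_of G) = svec ` colors G"
  by (simp_all add: lie_algebra_of_def)

lemma nilpotent_lie_algebra_of:
  assumes "finite (verts G)" "finite (colors G)"
    and anti: "\<And>v w. (v, w) \<in> arcs G \<Longrightarrow> (w, v) \<notin> arcs G"
    and col: "\<And>v w. (v, w) \<in> arcs G \<Longrightarrow> color G (v, w) \<in> colors G"
  shows "nilpotent_lie_algebra (underlying_space (lie_algebra_of G)) (gbr G)"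
proof -
  let ?L = "underlying_space (lie_algebra_of G)"
  note b = bilinear_bracket[of G]
  have sub: "gbr G f g \<in> span (svec ` colors G)" for f g using bracket_in_span[OF col] .
  \<comment> \<open>Each of the three terms of the Jacobi identity has this form.\<close>
  have central: "gbr G f (gbr G g h) = 0" for f g h
    by (rule bracket_central) (use sub[of g h] span_mono[of "svec ` colors G" "range svec"] in blast)
  have "lie_algebra ?L (gbr G)"
  proof
    show "subspace ?L" by simp
    show "\<exists>B. finite B \<and> ?L = span B"
      using assms(1,2) by (intro exI[of _ "vvec ` verts G \<union> svec ` colors G"]) simp
    show "gbr G x y \<in> ?L" for x y
      using sub[of x y] span_mono[of "svec ` colors G" "vvec ` verts G \<union> svec ` colors G"] by auto
  qed (simp_all add: bilinear_ladd[OF b] bilinear_radd[OF b] bilinear_lmul[OF b]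
        bilinear_rmul[OF b] central bracket_alternating[OF anti])
  \<comment> \<open>The series starts with \<open>?L\<close> at index 0, so index 2 is the span of
    all \<open>[x, y]\<close> with \<open>y\<close> in the derived algebra.\<close>
  moreover have "lower_central_series ?L (gbr G) 2 = {0}"
  proof -
    have "span {gbr G x y | x y. x \<in> ?L \<and> y \<in> ?L} \<subseteq> span (range svec)" (is "?C \<subseteq> _")
      using sub span_mono[of "svec ` colors G" "range svec"] by (intro span_minimal) auto
    then have "{gbr G x y | x y. x \<in> ?L \<and> y \<in> ?C} \<subseteq> {0}"
      using bracket_central[of _ G] by blast
    then have "span {gbr G x y | x y. x \<in> ?L \<and> y \<in> ?C} = {0}"
      by (intro equalityI span_minimal) (auto simp: span_zero)
    then show ?thesis unfolding numeral_2_eq_2 lower_central_series.simps .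
  qed
  ultimately show ?thesis unfolding nilpotent_lie_algebra_def by blast
qed

section \<open>From a uniformly colored digraph to a uniform basis\<close>

locale uniform_digraph =
  fixes p q r s :: nat and G :: "('v, 's) colored_digraph" and c :: "'v set \<Rightarrow> 's"
    and E :: "'v set set"
  defines "E \<equiv> {{v, w} | v w. (v, w) \<in> arcs G}"
  assumes anti: "(v, w) \<in> arcs G \<Longrightarrow> (w, v) \<notin> arcs G"
    and coloring: "uniform_edge_coloring p q r s (verts G) E c (colors G)"
    and color_eq: "(v, w) \<in> arcs G \<Longrightarrow> color G (v, w) = c {v, w}"
begin

lemma pos: "p > 0" "q > 0" "r > 0" "s > 0" "finite (verts G)" "card (verts G) = q" "card (colors G) = p"
  and edges: "E \<subseteq> {e. e \<subseteq> verts G \<and> card e = 2}"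
  and card_incident: "v \<in> verts G \<Longrightarrow> card {e \<in> E. v \<in> e} = s"
  and color_image: "c ` E = colors G"
  and card_color_class: "k \<in> colors G \<Longrightarrow> card {e \<in> E. c e = k} = r"
  using coloring unfolding uniform_edge_coloring_def by (simp_all only: Suc_le_eq One_nat_def)

lemma proper:
  assumes "e \<in> E" "e' \<in> E" "e \<inter> e' \<noteq> {}" "c e = c e'"
  shows "e = e'"
proof -
  have "\<forall>e\<in>E. \<forall>e'\<in>E. e \<noteq> e' \<and> e \<inter> e' \<noteq> {} \<longrightarrow> c e \<noteq> c e'"
    using coloring unfolding uniform_edge_coloring_def by (elim conjE)
  then show ?thesis using assms by blast
qed

lemma arc_edge: "(v, w) \<in> arcs G \<Longrightarrow> {v, w} \<in> E"
  unfolding E_def by blast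

lemma arc_verts: "(v, w) \<in> arcs G \<Longrightarrow> v \<in> verts G \<and> w \<in> verts G"
  using subsetD[OF edges arc_edge] by simp

lemma arc_color: "(v, w) \<in> arcs G \<Longrightarrow> color G (v, w) \<in> colors G"
  using imageI[OF arc_edge, of v w c] by (simp add: color_image color_eq)

lemma arc_irrefl: "(v, v) \<notin> arcs G"
  using anti by blast

lemma card_neighbours: "v \<in> verts G \<Longrightarrow> card {w. (w, v) \<in> arcs G \<or> (v, w) \<in> arcs G} = s"
  using card_incident[of v] card_incident_edges[OF arc_irrefl, of v] unfolding E_def by simp

text \<open>Both edges contain \<open>u\<close> and have the same color, so properness makes them
  equal. This is the graph form of injectivity of the bracket up to sign.\<close>

lemma proper_neighbours:
  assumes "(u, v) \<in> arcs G \<or> (v, u) \<in> arcs G" "(u, w) \<in> arcs G \<or> (w, u) \<in> arcs G"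
    and "c {u, v} = c {u, w}"
  shows "v = w"
proof -
  have "{u, v} \<in> E" "{u, w} \<in> E" using assms(1,2) arc_edge insert_commute by metis+
  then have "{u, v} = {u, w}" using proper assms(3) by blast
  then show ?thesis by (auto simp: doubleton_eq_iff)
qed

lemma card_arc_color_class:
  assumes "k \<in> colors G"
  shows "card {{v, w} | v w. (v, w) \<in> arcs G \<and> color G (v, w) = k} = r"
proof -
  have "{{v, w} | v w. (v, w) \<in> arcs G \<and> color G (v, w) = k} = {e \<in> E. c e = k}"
    using color_eq unfolding E_def by force
  then show ?thesis using card_color_class[OF assms] by simp
qed

lemma nilpotent: "nilpotent_lie_algebra (underlying_space (lie_algebra_of G)) (gbr G)"
  using nilpotent_lie_algebra_of pos anti arc_color card_ge_0_finite by metis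

text \<open>A reversed arc contributes \<open>- svec\<close>, which is never some
  \<open>svec k\<close>. The sign of the bracket therefore recovers the orientation.\<close>

lemma bracket_eq_svec_iff:
  "gbr G (vvec v) (vvec w) = svec k \<longleftrightarrow> (v, w) \<in> arcs G \<and> color G (v, w) = k"
  by (auto simp: svec_nonzero[symmetric])

lemma bracket_eq_0_iff:
  "gbr G (vvec v) (vvec w) = 0 \<longleftrightarrow> (v, w) \<notin> arcs G \<and> (w, v) \<notin> arcs G"
  by auto

lemma iso_digraph_of: "colored_digraph_iso vvec svec G (digraph_of (lie_algebra_of G))"
  unfolding colored_digraph_iso_def
proof (intro conjI)
  show "\<forall>v\<in>verts G. \<forall>w\<in>verts G. (v, w) \<in> arcs G \<longleftrightarrow>
      (vvec v, vvec w) \<in> arcs (digraph_of (lie_algebra_of G))"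
    using arc_color by (auto simp: digraph_of_def image_iff bracket_eq_svec_iff simp del: bracket_vvec)
qed (auto simp: digraph_of_def bij_betw_def inj_on_def)

lemma uniform_basis:
  "uniform_basis p q r s (underlying_space (lie_algebra_of G)) (gbr G)
     (vvec ` verts G) (svec ` colors G)"
proof (rule uniform_basisI)
  show "card (vvec ` verts G) = q" "card (svec ` colors G) = p"
    using pos by (auto simp: card_image inj_on_def)
  show "vvec ` verts G \<inter> svec ` colors G = {}" by auto
  show "independent (vvec ` verts G \<union> svec ` colors G)" by (rule independent_vvec_svec)
  show "gbr G v w \<in> {0} \<union> svec ` colors G \<union> uminus ` svec ` colors G"
    if "v \<in> vvec ` verts G" "w \<in> vvec ` verts G" for v w
    using that arc_color by auto
  show "v = w" if uvw: "u \<in> vvec ` verts G" "v \<in> vvec ` verts G" "w \<in> vvec ` verts G"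
    "gbr G u v \<noteq> 0" "gbr G u v = gbr G u w \<or> gbr G u v = - gbr G u w" for u v w
  proof -
    obtain u' v' w' where [simp]: "u = vvec u'" "v = vvec v'" "w = vvec w'" using uvw by blast
    have 1: "(u', v') \<in> arcs G \<or> (v', u') \<in> arcs G"
      using uvw(4) bracket_eq_0_iff[of u' v'] by (simp del: bracket_vvec)
    have "gbr G u w \<noteq> 0" using uvw(4,5) by (metis neg_equal_0_iff_equal)
    then have 2: "(u', w') \<in> arcs G \<or> (w', u') \<in> arcs G"
      using bracket_eq_0_iff[of u' w'] by (simp del: bracket_vvec)
    \<comment> \<open>The sign of a bracket records only the orientation, so equality up to sign is
      equality of the colors of the undirected edges.\<close>
    have "c {u', v'} = c {u', w'}"
      using uvw(5) 1 2 anti by (auto simp: color_eq insert_commute split: if_splits)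
    then show "v = w" using proper_neighbours[OF 1 2] by simp
  qed
  show "card {{v, w} | v w. v \<in> vvec ` verts G \<and> w \<in> vvec ` verts G \<and> gbr G v w = z} = r"
    if z: "z \<in> svec ` colors G" for z
  proof -
    obtain k where k: "z = svec k" "k \<in> colors G" using z by blast
    have "{{v, w} | v w. v \<in> vvec ` verts G \<and> w \<in> vvec ` verts G \<and> gbr G v w = z}
        = (`) vvec ` {{v, w} | v w. (v, w) \<in> arcs G \<and> color G (v, w) = k}" (is "?A = ?B")
    proof (intro equalityI subsetI)
      fix e assume "e \<in> ?A"
      then obtain v w where "e = vvec ` {v, w}" "gbr G (vvec v) (vvec w) = z" by auto
      then show "e \<in> ?B" unfolding k bracket_eq_svec_iff by blast
    next
      fix e assume "e \<in> ?B"
      then obtain v w where "e = {vvec v, vvec w}" "(v, w) \<in> arcs G" "color G (v, w) = k" by auto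
      then show "e \<in> ?A" using arc_verts bracket_eq_svec_iff[of v w k] k(1) by blast
    qed
    \<comment> \<open>Injectivity of \<open>vvec\<close> passes to images of sets, so pairs of basis
      vectors are counted by edges.\<close>
    moreover have "inj_on ((`) (vvec :: 'v \<Rightarrow> 'v + 's \<Rightarrow>\<^sub>0 real)) X" for X
      by (simp add: inj_on_def inj_image_eq_iff)
    ultimately show ?thesis using card_arc_color_class[OF k(2)] by (simp add: card_image)
  qed
  show "card {v \<in> vvec ` verts G. gbr G v w \<noteq> 0} = s" if w: "w \<in> vvec ` verts G" for w
  proof -
    obtain w' where w': "w = vvec w'" "w' \<in> verts G" using w by blast
    \<comment> \<open>A bracket with \<open>w\<close> is nonzero exactly for neighbours of
      \<open>w'\<close>, whichever way the arc points.\<close>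
    have "{v \<in> vvec ` verts G. gbr G v w \<noteq> 0} = vvec ` {v. (v, w') \<in> arcs G \<or> (w', v) \<in> arcs G}"
      unfolding w' using arc_verts by (auto simp: bracket_eq_0_iff simp del: bracket_vvec)
    then show ?thesis using card_neighbours[OF w'(2)] by (simp add: card_image inj_on_def)
  qed

qed (use pos in auto)

end

lemma uniform_digraph_exists:
  assumes "uniformly_colored_digraph p q r s G"
  shows "\<exists>c. uniform_digraph p q r s G c"
  using assms unfolding uniformly_colored_digraph_def uniform_digraph_def by (elim conjE exE) (intro exI conjI; assumption)

section \<open>The graph of a uniform Lie algebra\<close>

locale uniform_based_lie =
  fixes p q r s :: nat and N :: "'a::real_vector based_lie_algebra"
  assumes uniform: "uniform_based_lie_algebra p q r s N"
begin

abbreviation "L \<equiv> underlying_space N"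
abbreviation "br \<equiv> bracket N"
abbreviation "V \<equiv> vbasis N"
abbreviation "Z \<equiv> zbasis N"

sublocale lie_algebra L br
  using uniform unfolding uniform_based_lie_algebra_def nilpotent_lie_algebra_def by blast

lemma pos: "p > 0" "q > 0" "r > 0" "s > 0" "card V = q" "card Z = p"
  and disjoint: "V \<inter> Z = {}"
  and independent: "independent (V \<union> Z)"
  and span: "span (V \<union> Z) = L"
  and br_vz: "\<lbrakk>v \<in> V; z \<in> Z\<rbrakk> \<Longrightarrow> br v z = 0"
  and br_zz: "\<lbrakk>z \<in> Z; z' \<in> Z\<rbrakk> \<Longrightarrow> br z z' = 0"
  and br_vv: "\<lbrakk>v \<in> V; w \<in> V\<rbrakk> \<Longrightarrow> br v w \<in> {0} \<union> Z \<union> uminus ` Z"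
  and card_class: "z \<in> Z \<Longrightarrow> card {{v, w} | v w. v \<in> V \<and> w \<in> V \<and> br v w = z} = r"
  and card_degree: "w \<in> V \<Longrightarrow> card {v \<in> V. br v w \<noteq> 0} = s"
  using uniform unfolding uniform_based_lie_algebra_def uniform_basis_def
  by (simp_all only: simp_thms)

lemma br_inj:
  assumes "u \<in> V" "v \<in> V" "w \<in> V" "br u v \<noteq> 0" "br u v = br u w \<or> br u v = - br u w"
  shows "v = w"
proof -
  have "\<forall>u\<in>V. \<forall>v\<in>V. \<forall>w\<in>V. br u v \<noteq> 0 \<and> (br u v = br u w \<or> br u v = - br u w) \<longrightarrow> v = w"
    using uniform unfolding uniform_based_lie_algebra_def uniform_basis_def by (elim conjE)
  then show ?thesis using assms by blast
qed

lemma in_L: "v \<in> V \<Longrightarrow> v \<in> L" "z \<in> Z \<Longrightarrow> z \<in> L"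
  by (simp_all add: span[symmetric] span_base)

lemma zbasis_nonzero: "z \<in> Z \<Longrightarrow> z \<noteq> 0"
  using independent dependent_zero[of "V \<union> Z"] by auto

text \<open>This prevents both orderings of a pair from having their bracket in \<open>Z\<close>, so
  no pair gets arcs in both directions.\<close>

lemma uminus_notin_zbasis: "z \<in> Z \<Longrightarrow> - z \<notin> Z"
  using independent_neq_uminus[OF independent] by (metis UnI2 minus_minus)

lemma br_swap: "\<lbrakk>v \<in> V; w \<in> V\<rbrakk> \<Longrightarrow> br v w = - br w v"
  using antisymmetric in_L by blast

text \<open>A nonzero bracket is \<open>z\<close> or \<open>- z\<close> for some \<open>z\<close> in
  \<open>Z\<close>; in the second case swapping the arguments gives \<open>z\<close>. Nonzero
  brackets are thus the undirected edges.\<close>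

lemma br_nonzero_iff:
  assumes "v \<in> V" "w \<in> V"
  shows "br v w \<noteq> 0 \<longleftrightarrow> br v w \<in> Z \<or> br w v \<in> Z"
  using br_vv[OF assms] br_swap[OF assms] zbasis_nonzero by force

lemma uniformly_colored_digraph_of: "uniformly_colored_digraph p q r s (digraph_of N)"
proof -
  define A where "A = arcs (digraph_of N)"
  have A: "(v, w) \<in> A \<longleftrightarrow> v \<in> V \<and> w \<in> V \<and> br v w \<in> Z" for v w
    by (simp add: A_def digraph_of_def)
  have anti: "(w, v) \<notin> A" if "(v, w) \<in> A" for v w
    using that uminus_notin_zbasis br_swap unfolding A by metis
  let ?E = "{{v, w} | v w. (v, w) \<in> A}"
  \<comment> \<open>An edge is an arc in only one direction, so on edges the choice is forced to be
    the bracket along that arc. Values elsewhere are irrelevant.\<close>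
  define c where "c e = (SOME z. \<exists>v w. e = {v, w} \<and> (v, w) \<in> A \<and> z = br v w)" for e
  have c: "c {v, w} = br v w" if "(v, w) \<in> A" for v w
    unfolding c_def
  proof (rule some_equality)
    fix z assume "\<exists>v' w'. {v, w} = {v', w'} \<and> (v', w') \<in> A \<and> z = br v' w'"
    then show "z = br v w" using that anti by (auto simp: doubleton_eq_iff)
  qed (use that in blast)
  \<comment> \<open>For either ordering of an edge, its color is the bracket up to sign, the form in
    which \<open>br_inj\<close> applies.\<close>
  have cE: "v \<in> V \<and> w \<in> V \<and> br v w \<noteq> 0 \<and> (c {v, w} = br v w \<or> c {v, w} = - br v w)"
    if "{v, w} \<in> ?E" for v w
  proof -
    have "(v, w) \<in> A \<or> (w, v) \<in> A" using that by (auto simp: doubleton_eq_iff)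
    then show ?thesis
    proof
      assume vw: "(v, w) \<in> A"
      then show ?thesis using A c[OF vw] zbasis_nonzero by metis
    next
      assume wv: "(w, v) \<in> A"
      then have "v \<in> V" "w \<in> V" "br w v \<in> Z" using A by auto
      moreover from this have "br w v = - br v w" by (intro br_swap)
      ultimately show ?thesis using c[OF wv] zbasis_nonzero
        by (metis insert_commute neg_equal_0_iff_equal)
    qed
  qed
  have "uniform_edge_coloring p q r s V ?E c Z"
    unfolding uniform_edge_coloring_def
  proof (intro conjI ballI impI)
    show "s \<ge> 1" "finite V" using pos by (auto intro: card_ge_0_finite)
    show "?E \<subseteq> {e. e \<subseteq> V \<and> card e = 2}"
      using anti by (auto simp: A card_2_iff) metis
    show "card {e \<in> ?E. v \<in> e} = s" if "v \<in> V" for v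
    proof -
      have "{w. (w, v) \<in> A \<or> (v, w) \<in> A} = {w \<in> V. br w v \<noteq> 0}"
        using that br_nonzero_iff unfolding A by blast
      then show ?thesis using card_incident_edges[of A v] anti card_degree[OF that] by metis
    qed
    \<comment> \<open>A pair of basis vectors with bracket \<open>z\<close> in \<open>Z\<close> is
      already an arc, and \<open>c\<close> takes the value \<open>z\<close> on it.\<close>
    have class_eq: "{e \<in> ?E. c e = z} = {{v, w} | v w. v \<in> V \<and> w \<in> V \<and> br v w = z}" if "z \<in> Z" for z
      using that c by (auto simp: A) (metis A c)
    show "card {e \<in> ?E. c e = k} = r" if "k \<in> Z" for k
      using class_eq[OF that] card_class[OF that] by simp
    show "c ` ?E = Z"
    proof (intro equalityI subsetI)
      fix z assume "z \<in> c ` ?E"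
      then obtain v w where "(v, w) \<in> A" "z = c {v, w}" by blast
      then show "z \<in> Z" using c A by metis
    next
      fix z assume z: "z \<in> Z"
      \<comment> \<open>Surjectivity of the coloring comes from \<open>r > 0\<close>: each color
        class is nonempty.\<close>
      then have "card {e \<in> ?E. c e = z} > 0" using class_eq[OF z] card_class[OF z] pos(3) by simp
      then have "{e \<in> ?E. c e = z} \<noteq> {}" by (metis card.empty less_irrefl)
      then obtain e where "e \<in> ?E" "c e = z" by (auto simp only: ex_in_conv[symmetric] mem_Collect_eq)
      then show "z \<in> c ` ?E" by (intro image_eqI) simp_all
    qed
    show "c e \<noteq> c e'" if e: "e \<in> ?E" "e' \<in> ?E" "e \<noteq> e' \<and> e \<inter> e' \<noteq> {}" for e e'
    proof
      assume eq: "c e = c e'"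
      \<comment> \<open>Both edges are written with their common vertex first, so that injectivity
        up to sign at \<open>u\<close> identifies the other endpoints.\<close>
      obtain u where "u \<in> e" "u \<in> e'" using e(3) by blast
      then obtain v w where vw: "e = {u, v}" "e' = {u, w}"
        using e(1,2) by (auto simp: insert_commute)
      note uv = cE[OF e(1)[unfolded vw]] and uw = cE[OF e(2)[unfolded vw]]
      have "br u v = br u w \<or> br u v = - br u w"
        using uv uw eq unfolding vw by auto
      then have "v = w" using br_inj[of u v w] uv uw by simp
      then show False using e(3) vw by blast
    qed
  qed (use pos in auto)
  moreover have "verts (digraph_of N) = V" "colors (digraph_of N) = Z"
    "color (digraph_of N) (v, w) = br v w" for v w
    by (auto simp: digraph_of_def)
  ultimately show ?thesis
    unfolding uniformly_colored_digraph_def A_def[symmetric]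
    by (intro conjI exI[of _ c] allI impI) (simp_all add: anti c)
qed

section \<open>The isomorphism from the reconstructed algebra to the original one\<close>

text \<open>Evaluation of formal combinations inside \<open>N\<close>. It is linear on the whole
  free space over \<open>'a + 'a\<close>; bijectivity is claimed only on the span of the copies of
  \<open>V\<close> and \<open>Z\<close>.\<close>

definition \<phi> :: "('a + 'a \<Rightarrow>\<^sub>0 real) \<Rightarrow> 'a" where
  "\<phi> = linext (case_sum id id)"

lemma linear_\<phi>: "linear \<phi>"
  unfolding \<phi>_def by (rule linear_linext)

lemma \<phi>_vvec [simp]: "\<phi> (vvec v) = v" and \<phi>_svec [simp]: "\<phi> (svec z) = z"
  by (simp_all add: \<phi>_def vvec_def svec_def)

abbreviation "H \<equiv> lie_algebra_of (digraph_of N)"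

lemma digraph_of_sel [simp]: "verts (digraph_of N) = V" "colors (digraph_of N) = Z"
  "color (digraph_of N) (v, w) = br v w"
  "(v, w) \<in> arcs (digraph_of N) \<longleftrightarrow> v \<in> V \<and> w \<in> V \<and> br v w \<in> Z"
  by (auto simp: digraph_of_def)

lemma \<phi>_image: "\<phi> ` (vvec ` V \<union> svec ` Z) = V \<union> Z"
  by (simp add: image_Un image_image)

text \<open>A linear map taking one basis injectively onto another is bijective between their
  spans.\<close>

lemma bij_\<phi>: "bij_betw \<phi> (underlying_space H) L"
proof -
  \<comment> \<open>Disjointness of \<open>V\<close> and \<open>Z\<close> keeps
    \<open>vvec v\<close> and \<open>svec z\<close> from having the same image.\<close>
  have "inj_on \<phi> (vvec ` V \<union> svec ` Z)"
    using disjoint by (auto simp: inj_on_def)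
  then have "inj_on \<phi> (span (vvec ` V \<union> svec ` Z))"
    by (intro linear_inj_on_span_independent_image linear_\<phi>) (simp add: \<phi>_image independent)
  moreover have "\<phi> ` span (vvec ` V \<union> svec ` Z) = L"
    using linear_span_image[OF linear_\<phi>] \<phi>_image span by metis
  ultimately show ?thesis by (simp add: bij_betw_def)
qed

lemma \<phi>_in_L: "x \<in> underlying_space H \<Longrightarrow> \<phi> x \<in> L"
  using bij_\<phi> bij_betwE by blast

lemma \<phi>_bracket_basis:
  assumes "x \<in> vvec ` V \<union> svec ` Z" "y \<in> vvec ` V \<union> svec ` Z"
  shows "\<phi> (gbr (digraph_of N) x y) = br (\<phi> x) (\<phi> y)"
proof -
  note l = linear_0[OF linear_\<phi>] linear_neg[OF linear_\<phi>]
  \<comment> \<open>The uniform basis conditions state only \<open>br v z = 0\<close>; this order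
    follows by antisymmetry.\<close>
  have br_zv: "br z v = 0" if "z \<in> Z" "v \<in> V" for z v
    using that antisymmetric[of z v] br_vz in_L by simp
  \<comment> \<open>Along an arc both sides agree by definition, against an arc by antisymmetry, and
    otherwise both vanish by \<open>br_nonzero_iff\<close>.\<close>
  have "\<phi> (gbr (digraph_of N) (vvec v) (vvec w)) = br v w" if vw: "v \<in> V" "w \<in> V" for v w
    using br_nonzero_iff[OF vw] br_swap[OF vw] vw by (auto simp: l)
  then show ?thesis
    using assms br_zv br_vz br_zz by (auto simp: l simp del: bracket_vvec)
qed

text \<open>Bilinearity extends the identity from basis vectors by two span inductions, first in
  \<open>y\<close> and then in \<open>x\<close>.\<close>

lemma \<phi>_bracket:
  assumes x: "x \<in> underlying_space H" and y: "y \<in> underlying_space H"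
  shows "\<phi> (gbr (digraph_of N) x y) = br (\<phi> x) (\<phi> y)"
proof -
  let ?B = "vvec ` V \<union> svec ` Z" and ?g = "gbr (digraph_of N)"
  note l = linear_0[OF linear_\<phi>] linear_add[OF linear_\<phi>] linear_scale[OF linear_\<phi>]
    bilinear_ladd[OF bilinear_bracket] bilinear_lmul[OF bilinear_bracket]
    bilinear_radd[OF bilinear_bracket] bilinear_rmul[OF bilinear_bracket]
    bilinear_lzero[OF bilinear_bracket] bilinear_rzero[OF bilinear_bracket]
  have H: "underlying_space H = span ?B" by simp
  have L0: "0 \<in> L" using subspace subspace_0 by blast
  have br0: "br 0 u = 0" "br u 0 = 0" if "u \<in> L" for u
    using scale_left[OF L0 that, of 0] scale_right[OF that L0, of 0] by simp_all
  have BL: "\<phi> b \<in> L" if "b \<in> ?B" for b using that in_L by auto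
  have S: "c *\<^sub>R u \<in> L" if "u \<in> L" for c u using that subspace subspace_scale by blast
  have A: "u + u' \<in> L" if "u \<in> L" "u' \<in> L" for u u' using that subspace subspace_add by blast
  \<comment> \<open>The bracket of \<open>N\<close> is known to be bilinear only on
    \<open>L\<close>, so membership in \<open>L\<close> is carried through the induction.\<close>
  have basis: "\<phi> y \<in> L \<and> \<phi> (?g b y) = br (\<phi> b) (\<phi> y)" if b: "b \<in> ?B" for b
    using y unfolding H
  proof (induction rule: span_induct_alt)
    case base
    then show ?case using br0 BL[OF b] L0 by (simp add: l)
  next
    case (step c b' y)
    then show ?case using \<phi>_bracket_basis[OF b step.hyps(1)] BL[OF b] BL[OF step.hyps(1)]
      by (simp add: l add_right scale_right S A)
  qed
  have "\<phi> x \<in> L \<and> \<phi> (?g x y) = br (\<phi> x) (\<phi> y)"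
    using x unfolding H
  proof (induction rule: span_induct_alt)
    case base
    then show ?case using br0 \<phi>_in_L[OF y] L0 by (simp add: l)
  next
    case (step c b x)
    then show ?case using basis[OF step.hyps(1)] BL[OF step.hyps(1)]
      by (simp add: l add_left scale_left S A)
  qed
  then show ?thesis ..
qed

lemma based_lie_algebra_iso_\<phi>: "based_lie_algebra_iso \<phi> H N"
  unfolding based_lie_algebra_iso_def
  using bij_\<phi> \<phi>_bracket linear_add[OF linear_\<phi>] linear_scale[OF linear_\<phi>]
  by (simp add: image_image)

end

theorem proposition4p9:
  fixes p q r s :: nat
  shows
    "(\<forall>G :: ('v, 's) colored_digraph. uniformly_colored_digraph p q r s G \<longrightarrow>
        uniform_lie_algebra p q r s (underlying_space (lie_algebra_of G)) (bracket (lie_algebra_of G)) \<and>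
        uniform_basis p q r s (underlying_space (lie_algebra_of G)) (bracket (lie_algebra_of G))
          (vvec ` verts G) (svec ` colors G) \<and>
        colored_digraph_iso vvec svec G (digraph_of (lie_algebra_of G))) \<and>
     (\<forall>N :: 'a::real_vector based_lie_algebra. uniform_based_lie_algebra p q r s N \<longrightarrow>
        uniformly_colored_digraph p q r s (digraph_of N) \<and>
        (\<exists>\<phi>. based_lie_algebra_iso \<phi> (lie_algebra_of (digraph_of N)) N \<and>
             (\<forall>v\<in>vbasis N. \<phi> (vvec v) = v) \<and> (\<forall>z\<in>zbasis N. \<phi> (svec z) = z)))"
proof (intro conjI allI impI)
  fix G :: "('v, 's) colored_digraph"
  assume "uniformly_colored_digraph p q r s G"
  then obtain c where "uniform_digraph p q r s G c"
    using uniform_digraph_exists by blast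
  then interpret uniform_digraph p q r s G c "{{v, w} | v w. (v, w) \<in> arcs G}" .
  show "uniform_basis p q r s (underlying_space (lie_algebra_of G)) (bracket (lie_algebra_of G))
      (vvec ` verts G) (svec ` colors G)"
    by (rule uniform_basis)
  then show "uniform_lie_algebra p q r s (underlying_space (lie_algebra_of G)) (bracket (lie_algebra_of G))"
    unfolding uniform_lie_algebra_def using nilpotent by blast
  show "colored_digraph_iso vvec svec G (digraph_of (lie_algebra_of G))"
    by (rule iso_digraph_of)
next
  fix N :: "'a based_lie_algebra"
  assume "uniform_based_lie_algebra p q r s N"
  then interpret uniform_based_lie p q r s N by unfold_locales
  show "uniformly_colored_digraph p q r s (digraph_of N)"
    by (rule uniformly_colored_digraph_of)
  show "\<exists>\<phi>. based_lie_algebra_iso \<phi> (lie_algebra_of (digraph_of N)) N \<and>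
      (\<forall>v\<in>vbasis N. \<phi> (vvec v) = v) \<and> (\<forall>z\<in>zbasis N. \<phi> (svec z) = z)"
    using based_lie_algebra_iso_\<phi> by (intro exI[of _ \<phi>]) simp
qed

end
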